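(* Let $m>0$, let $\Omega$ be an open subset of $\mathbb{M}^{1+2}$, let $A=(A_0,A_1,A_2)$ be a given smooth real covector field on $\mathbb{M}^{1+2}$, and let $\eta:\Omega\to\mathbb{C}^2$ be a smooth spinor field satisfying the condition $$\bar\eta^{\dot a}\sigma_{3\dot ab}\eta^b>0 .$$ For $r\in\{+1,-1\}$ let $$L_r(\eta)=-\frac{16}{9\,\bar\eta^{\dot c}\sigma_{3\dot cd}\eta^d}\Bigl(\bigl[\tfrac12\bigl(\bar\eta^{\dot a}\sigma^\alpha{}_{\dot ab}(i\partial_\alpha+rA_\alpha)\eta^b-\eta^b\sigma^\alpha{}_{\dot ab}(i\partial_\alpha-rA_\alpha)\bar\eta^{\dot a}\bigr)\bigr]^2-\bigl(m\,\bar\eta^{\dot a}\sigma_{3\dot ab}\eta^b\bigr)^2\Bigr),$$ and for $r,s\in\{+1,-1\}$ let $D_{rs}$ be the linear differential operator $$(D_{rs}\eta)_{\dot a}=\sigma^\alpha{}_{\dot ab}(i\partial_\alpha+rA_\alpha)\eta^b+s\,m\,\sigma^3{}_{\dot ab}\eta^b ,$$ where $\alpha$ is summed over $0,1,2$. Write $L_\pm$ for $L_{\pm1}$, and $D_{++},D_{+-},D_{-+},D_{--}$ for $D_{rs}$ with the corresponding signs $r,s$. Then: (1) $\eta$ is a solution of the field equation (Euler--Lagrange equation) for the Lagrangian density $L_+$ if and only if it is a solution of the Dirac equation $D_{++}\eta=0$ or the Dirac equation $D_{+-}\eta=0$; (2) $\eta$ is a solution of the field equation for the Lagrangian density $L_-$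 if and only if it is a solution of the Dirac equation $D_{-+}\eta=0$ or the Dirac equation $D_{--}\eta=0$.
   Context: $\mathbb{M}^{1+2}$ is $(1+2)$-dimensional Minkowski spacetime, i.e. $\mathbb{R}^3$ with coordinates $x^\alpha$, $\alpha=0,1,2$, and metric $\operatorname{diag}(-1,+1,+1)$; openness of subsets is understood in the Euclidean sense; $\partial_\alpha=\partial/\partial x^\alpha$. All fields are infinitely smooth, with no assumption on behaviour at infinity. $A$ is a prescribed external electromagnetic covector potential (it is not varied) and $m$ is the electron mass. Spinor indices $a,b,\dots$ run over $1,2$ and dotted indices over $\dot1,\dot2$; repeated indices are summed; $\bar\eta^{\dot a}$ is the complex conjugate of $\eta^a$. The Pauli matrices (first index row, second index column) are $$\sigma_{0}=\begin{pmatrix}1&0\\0&1\end{pmatrix}=-\sigma^0,\quad \sigma_1=\begin{pmatrix}0&1\\1&0\end{pmatrix}=\sigma^1,\quad \sigma_2=\begin{pmatrix}0&-i\\i&0\end{pmatrix}=\sigma^2,\quad \sigma_3=\begin{pmatrix}1&0\\0&-1\end{pmatrix}=\sigma^3 .$$ Thus, for example, $\bar\eta^{\dot a}\sigma_{3\dot ab}\eta^b=|\eta^1|^2-|\eta^2|^2$. The field equation for a Lagrangian density $L$ is the Euler--Lagrange equation of the action $S(\eta)=\int L(\eta)\,dx^0dx^1dx^2$ with respect to the complex field $\eta$: $\eta$ is a solution on $\Omega$ if the first variation $\delta\int L(\eta)=\int_\Omega\frac{d}{dt}\big|_{t=0}L(\eta+t\,\delta\eta)\,dx^0dx^1dx^2$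 vanishes for every $\delta\eta\in C_0^\infty(\Omega;\mathbb{C}^2)$. The action integral itself need not converge.
   Formalization: For disconnected Ω the "or" between the two Dirac equations fails globally (opposite mass signs on two components); it is proved as stated for connected Ω, and for every open Ω with the alternative taken separately on each connected component. *)

theory Defs
  imports "HOL-Analysis.Analysis"
begin

text \<open>
  Spacetime is \<open>real ^ 3\<close>. The elements of the index type \<open>3\<close> are \<open>0, 1, 2\<close> (with \<open>3 = 0\<close>), so
  \<open>x $ 0\<close>, \<open>x $ 1\<close>, \<open>x $ 2\<close> are the three coordinates. Spinors are \<open>complex ^ 2\<close>, with
  components \<open>$ 1\<close> and \<open>$ 2\<close>; the (dotted) row index of a Pauli matrix comes first. Fields are
  total functions of which only the values on the open set in question matter.
\<close>

definition partial :: "3 \<Rightarrow> (real ^ 3 \<Rightarrow> 'b::real_normed_vector) \<Rightarrow> real ^ 3 \<Rightarrow> 'b" where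
  "partial \<alpha> f x = vector_derivative (\<lambda>t::real. f (x + t *\<^sub>R axis \<alpha> 1)) (at 0)"

text \<open>\<open>C\<^sup>k\<close> regularity; only meant for open sets \<open>S\<close>.\<close>

primrec Ck_on :: "nat \<Rightarrow> (real ^ 3) set \<Rightarrow> (real ^ 3 \<Rightarrow> 'b::real_normed_vector) \<Rightarrow> bool" where
  "Ck_on 0 S f \<longleftrightarrow> continuous_on S f"
| "Ck_on (Suc k) S f \<longleftrightarrow> (\<forall>x\<in>S. f differentiable (at x)) \<and> (\<forall>\<alpha>. Ck_on k S (partial \<alpha> f))"

definition smooth_on :: "(real ^ 3) set \<Rightarrow> (real ^ 3 \<Rightarrow> 'b::real_normed_vector) \<Rightarrow> bool" where
  "smooth_on S f \<longleftrightarrow> (\<forall>k. Ck_on k S f)"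

text \<open>\<open>C\<^sub>0\<^sup>\<infinity>\<close>, as functions on the whole space that vanish outside a compact subset of \<open>S\<close>.\<close>

definition test_field :: "(real ^ 3) set \<Rightarrow> (real ^ 3 \<Rightarrow> 'b::real_normed_vector) \<Rightarrow> bool" where
  "test_field S \<phi> \<longleftrightarrow>
     smooth_on UNIV \<phi> \<and> compact (closure {x. \<phi> x \<noteq> 0}) \<and> closure {x. \<phi> x \<noteq> 0} \<subseteq> S"

text \<open>The matrices with lower tensor index, \<open>\<sigma>\<^sub>0, \<sigma>\<^sub>1, \<sigma>\<^sub>2, \<sigma>\<^sub>3\<close>.\<close>

definition pauli :: "nat \<Rightarrow> complex ^ 2 ^ 2" where
  "pauli k =
    (if k = 0 then vector [vector [1, 0], vector [0, 1]]
     else if k = 1 then vector [vector [0, 1], vector [1, 0]]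
     else if k = 2 then vector [vector [0, - \<i>], vector [\<i>, 0]]
     else vector [vector [1, 0], vector [0, - 1]])"

text \<open>
  The tensor index is raised with the metric \<open>diag(-1, 1, 1)\<close>. The matrix \<open>\<sigma>\<^sup>3 = \<sigma>\<^sub>3\<close> does not
  belong to a spacetime direction and is written \<open>pauli 3\<close>.
\<close>

definition sigma_up :: "3 \<Rightarrow> complex ^ 2 ^ 2" where
  "sigma_up \<alpha> = (if \<alpha> = 0 then - pauli 0 else if \<alpha> = 1 then pauli 1 else pauli 2)"

definition sigma3_form :: "complex ^ 2 \<Rightarrow> complex" where
  "sigma3_form v = (\<Sum>a\<in>UNIV. \<Sum>b\<in>UNIV. cnj (v $ a) * pauli 3 $ a $ b * v $ b)"

lemma sigma3_form_eq:
  "sigma3_form v = complex_of_real ((cmod (v $ 1))\<^sup>2 - (cmod (v $ 2))\<^sup>2)"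
  by (simp add: sigma3_form_def pauli_def sum_2 complex_norm_square mult.commute
      del: of_real_power)

definition kinetic_form ::
  "real \<Rightarrow> (real ^ 3 \<Rightarrow> real ^ 3) \<Rightarrow> (real ^ 3 \<Rightarrow> complex ^ 2) \<Rightarrow> real ^ 3 \<Rightarrow> complex" where
  "kinetic_form r A \<eta> x = 1 / 2 *
    ((\<Sum>\<alpha>\<in>UNIV. \<Sum>a\<in>UNIV. \<Sum>b\<in>UNIV. cnj (\<eta> x $ a) * sigma_up \<alpha> $ a $ b *
        (\<i> * partial \<alpha> (\<lambda>y. \<eta> y $ b) x + of_real (r * A x $ \<alpha>) * \<eta> x $ b))
   - (\<Sum>\<alpha>\<in>UNIV. \<Sum>a\<in>UNIV. \<Sum>b\<in>UNIV. \<eta> x $ b * sigma_up \<alpha> $ a $ b *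
        (\<i> * partial \<alpha> (\<lambda>y. cnj (\<eta> y $ a)) x - of_real (r * A x $ \<alpha>) * cnj (\<eta> x $ a))))"

text \<open>
  Both quadratic forms are real (\<open>sigma3_form_eq\<close> and \<open>kinetic_form_real\<close> below), so taking real
  parts only changes the type.
\<close>

definition lagrangian ::
  "real \<Rightarrow> real \<Rightarrow> (real ^ 3 \<Rightarrow> real ^ 3) \<Rightarrow> (real ^ 3 \<Rightarrow> complex ^ 2) \<Rightarrow> real ^ 3 \<Rightarrow> real" where
  "lagrangian r m A \<eta> x =
     - (16 / (9 * Re (sigma3_form (\<eta> x)))) *
       ((Re (kinetic_form r A \<eta> x))\<^sup>2 - (m * Re (sigma3_form (\<eta> x)))\<^sup>2)"

lemma partial_cnj:
  assumes "\<eta> differentiable (at x)"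
  shows "partial \<alpha> (\<lambda>y. cnj (\<eta> y $ a)) x = cnj (partial \<alpha> (\<lambda>y. \<eta> y $ a) x)"
proof -
  have "((\<lambda>y. \<eta> y $ a) \<circ> (\<lambda>t::real. x + t *\<^sub>R axis \<alpha> 1)) differentiable (at 0)"
  proof (rule differentiable_chain_at)
    show "(\<lambda>t::real. x + t *\<^sub>R axis \<alpha> 1) differentiable (at 0)"
      by (auto intro!: derivative_intros)
    obtain D where "(\<eta> has_derivative D) (at x)"
      using assms by (auto simp: differentiable_def)
    then have "((\<lambda>y. \<eta> y $ a) has_derivative (\<lambda>h. D h $ a)) (at x)"
      by (rule bounded_linear.has_derivative[OF bounded_linear_vec_nth])
    then show "(\<lambda>y. \<eta> y $ a) differentiable (at (x + 0 *\<^sub>R axis \<alpha> 1))"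
      by (auto simp: differentiable_def)
  qed
  then have "((\<lambda>t::real. \<eta> (x + t *\<^sub>R axis \<alpha> 1) $ a) has_vector_derivative
      partial \<alpha> (\<lambda>y. \<eta> y $ a) x) (at 0)"
    by (simp add: partial_def o_def vector_derivative_works)
  from vector_derivative_at[OF has_vector_derivative_cnj[OF this]] show ?thesis
    unfolding partial_def .
qed

lemma kinetic_form_real:
  assumes "\<eta> differentiable (at x)"
  shows "kinetic_form r A \<eta> x \<in> \<real>"
proof -
  have "(3 :: 3) = 0"
    by simp
  then have sum_012: "sum f (UNIV :: 3 set) = f 1 + f 2 + f 0" for f :: "3 \<Rightarrow> complex"
    by (metis sum_3)
  have "Im (kinetic_form r A \<eta> x) = 0"
    by (simp add: kinetic_form_def partial_cnj[OF assms] sum_012 sum_2 sigma_up_def pauli_def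
        algebra_simps add_divide_distrib diff_divide_distrib)
  then show ?thesis
    by (simp add: complex_is_Real_iff)
qed

text \<open>
  The first variation in the direction of every test field exists and vanishes. Outside the
  support of \<open>\<phi>\<close> the integrand is zero, hence the action itself need not converge.
\<close>

definition field_equation ::
  "(real ^ 3) set \<Rightarrow> ((real ^ 3 \<Rightarrow> complex ^ 2) \<Rightarrow> real ^ 3 \<Rightarrow> real) \<Rightarrow>
    (real ^ 3 \<Rightarrow> complex ^ 2) \<Rightarrow> bool" where
  "field_equation \<Omega> L \<eta> \<longleftrightarrow>
     (\<forall>\<phi>. test_field \<Omega> \<phi> \<longrightarrow>
        ((\<lambda>x. deriv (\<lambda>t::real. L (\<lambda>y. \<eta> y + t *\<^sub>R \<phi> y) x) 0) has_integral 0) \<Omega>)"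

definition dirac ::
  "real \<Rightarrow> real \<Rightarrow> real \<Rightarrow> (real ^ 3 \<Rightarrow> real ^ 3) \<Rightarrow> (real ^ 3 \<Rightarrow> complex ^ 2) \<Rightarrow> real ^ 3 \<Rightarrow> complex ^ 2"
  where
  "dirac r s m A \<eta> x = (\<chi> a.
     (\<Sum>\<alpha>\<in>UNIV. \<Sum>b\<in>UNIV. sigma_up \<alpha> $ a $ b *
        (\<i> * partial \<alpha> (\<lambda>y. \<eta> y $ b) x + of_real (r * A x $ \<alpha>) * \<eta> x $ b))
   + (\<Sum>b\<in>UNIV. of_real (s * m) * pauli 3 $ a $ b * \<eta> x $ b))"

text \<open>
  If \<open>\<Omega>\<close> is disconnected, a field may solve the Dirac equation with one sign of the mass term on
  one component and with the other sign on another component, and it then still satisfies the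
  field equation. The alternative between the two Dirac equations therefore has to be taken on
  each connected component; for connected \<open>\<Omega>\<close> it is an alternative on the whole of \<open>\<Omega>\<close>.
\<close>

definition dirac_solution ::
  "(real ^ 3) set \<Rightarrow> real \<Rightarrow> real \<Rightarrow> real \<Rightarrow> (real ^ 3 \<Rightarrow> real ^ 3) \<Rightarrow>
    (real ^ 3 \<Rightarrow> complex ^ 2) \<Rightarrow> bool" where
  "dirac_solution S r s m A \<eta> \<longleftrightarrow> (\<forall>x\<in>S. dirac r s m A \<eta> x = 0)"

end

theory Submission
  imports Defs "HOL-Computational_Algebra.Polynomial"
begin

text \<open>
  Write \<open>\<rho>\<close> for the density \<open>\<eta>\<close>-bar \<open>\<sigma>\<^sub>3 \<eta>\<close> and \<open>K\<close> for the kinetic form. With respect to the real inner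
  product on \<open>complex ^ 2\<close> the matrices \<open>\<sigma>\<^sup>\<alpha>\<close> are symmetric and \<open>\<i> \<sigma>\<^sup>\<alpha>\<close> are skew, so \<open>K = \<eta> \<bullet> D\<^sub>0 \<eta>\<close>
  with the massless Dirac operator \<open>D\<^sub>0\<close>, and \<open>\<delta>K = 2 \<delta>\<eta> \<bullet> D\<^sub>0 \<eta>\<close> up to a divergence.
  The variation \<open>\<delta>\<eta> = h \<eta>\<close> with a real function \<open>h\<close> gives \<open>\<delta>L = 2 h L\<close>. Hence \<open>L = 0\<close> on solutions,
  that is \<open>K = - s m \<rho>\<close> with \<open>s = \<plusminus>1\<close>. Since \<open>\<rho> > 0\<close>, the sign \<open>s = - K / (m \<rho>)\<close> is continuous and
  therefore locally constant. Once \<open>K = - s m \<rho>\<close> is known, \<open>\<delta>L\<close> is a constant multiple of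
  \<open>\<delta>\<eta> \<bullet> (s D\<^sub>0 \<eta> + m \<sigma>\<^sub>3 \<eta>)\<close> up to a divergence, and the second factor is \<open>s\<close> times the Dirac
  operator with mass sign \<open>s\<close>.
\<close>

section \<open>Calculus of \<open>C\<^sup>k\<close> functions\<close>

lemma has_derivative_imp_partial:
  assumes "(f has_derivative D) (at x)"
  shows "partial \<alpha> f x = D (axis \<alpha> 1)"
proof -
  have "(f has_derivative D) (at (x + 0 *\<^sub>R axis \<alpha> 1))"
    using assms by simp
  moreover have "((\<lambda>t::real. x + t *\<^sub>R axis \<alpha> 1) has_derivative (\<lambda>t. t *\<^sub>R axis \<alpha> 1)) (at 0)"
    by (auto intro!: derivative_eq_intros)
  ultimately have "((\<lambda>t::real. f (x + t *\<^sub>R axis \<alpha> 1)) has_derivative (\<lambda>t. D (t *\<^sub>R axis \<alpha> 1))) (at 0)"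
    by (rule has_derivative_compose[rotated])
  moreover have "(\<lambda>t. D (t *\<^sub>R axis \<alpha> 1)) = (\<lambda>t. t *\<^sub>R D (axis \<alpha> 1))"
    using has_derivative_linear[OF assms] by (simp add: linear_scale)
  ultimately show ?thesis
    unfolding partial_def by (intro vector_derivative_at) (simp add: has_vector_derivative_def)
qed

text \<open>The derivative along a coordinate line is needed at every parameter and within any set,
  because a family of translates is later differentiated under the integral sign.\<close>

lemma partial_has_vector_derivative:
  assumes "f differentiable (at (x + t *\<^sub>R axis \<alpha> 1))"
  shows "((\<lambda>t::real. f (x + t *\<^sub>R axis \<alpha> 1)) has_vector_derivative partial \<alpha> f (x + t *\<^sub>R axis \<alpha> 1)) (at t within T)"
proof -
  obtain D where D: "(f has_derivative D) (at (x + t *\<^sub>R axis \<alpha> 1))"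
    using assms by (auto simp: differentiable_def)
  have "((\<lambda>t::real. x + t *\<^sub>R axis \<alpha> 1) has_derivative (\<lambda>t. t *\<^sub>R axis \<alpha> 1)) (at t within T)"
    by (auto intro!: derivative_eq_intros)
  then have "((\<lambda>t::real. f (x + t *\<^sub>R axis \<alpha> 1)) has_derivative (\<lambda>t. D (t *\<^sub>R axis \<alpha> 1))) (at t within T)"
    using has_derivative_compose[where g = f and g' = D and f = "\<lambda>t::real. x + t *\<^sub>R axis \<alpha> 1"] D by blast
  moreover have "(\<lambda>t. D (t *\<^sub>R axis \<alpha> 1)) = (\<lambda>t. t *\<^sub>R D (axis \<alpha> 1))"
    using has_derivative_linear[OF D] by (simp add: linear_scale)
  ultimately show ?thesis
    by (simp add: has_vector_derivative_def has_derivative_imp_partial[OF D])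
qed

lemma partial_bilinear:
  assumes "bounded_bilinear B" "f differentiable (at x)" "g differentiable (at x)"
  shows "partial \<alpha> (\<lambda>y. B (f y) (g y)) x = B (f x) (partial \<alpha> g x) + B (partial \<alpha> f x) (g x)"
proof -
  obtain D E where D: "(f has_derivative D) (at x)" and E: "(g has_derivative E) (at x)"
    using assms by (auto simp: differentiable_def)
  show ?thesis
    using has_derivative_imp_partial[OF bounded_bilinear.FDERIV[OF assms(1) D E]]
    by (simp add: has_derivative_imp_partial[OF D] has_derivative_imp_partial[OF E])
qed

lemma partial_linear:
  assumes "bounded_linear T" "f differentiable (at x)"
  shows "partial \<alpha> (\<lambda>y. T (f y)) x = T (partial \<alpha> f x)"
proof -
  obtain D where D: "(f has_derivative D) (at x)"
    using assms by (auto simp: differentiable_def)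
  show ?thesis
    using has_derivative_imp_partial[OF bounded_linear.has_derivative[OF assms(1) D]]
    by (simp add: has_derivative_imp_partial[OF D])
qed

lemma partial_add:
  assumes "f differentiable (at x)" "g differentiable (at x)"
  shows "partial \<alpha> (\<lambda>y. f y + g y) x = partial \<alpha> f x + partial \<alpha> g x"
proof -
  obtain D E where D: "(f has_derivative D) (at x)" and E: "(g has_derivative E) (at x)"
    using assms by (auto simp: differentiable_def)
  show ?thesis
    using has_derivative_imp_partial[OF has_derivative_add[OF D E]]
    by (simp add: has_derivative_imp_partial[OF D] has_derivative_imp_partial[OF E])
qed

lemma partial_const [simp]: "partial \<alpha> (\<lambda>_. c) = (\<lambda>_. 0)"
  by (simp add: partial_def fun_eq_iff)

section \<open>Locality of derivatives on open sets\<close>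

lemma partial_cong:
  assumes "open S" "x \<in> S" "\<And>y. y \<in> S \<Longrightarrow> f y = g y"
  shows "partial \<alpha> f x = partial \<alpha> g x"
proof -
  have "open ((\<lambda>t::real. x + t *\<^sub>R axis \<alpha> 1) -` S)"
    by (intro open_vimage assms(1) continuous_intros)
  then have "\<forall>\<^sub>F t in nhds (0::real). x + t *\<^sub>R axis \<alpha> 1 \<in> S"
    using assms(2) by (auto simp: eventually_nhds)
  then have "\<forall>\<^sub>F t in nhds (0::real). f (x + t *\<^sub>R axis \<alpha> 1) = g (x + t *\<^sub>R axis \<alpha> 1)"
    by eventually_elim (use assms in auto)
  then show ?thesis
    unfolding partial_def by (intro vector_derivative_cong_eq) auto
qed

lemma differentiable_cong:
  assumes "open S" "x \<in> S" "\<And>y. y \<in> S \<Longrightarrow> f y = g y" "f differentiable (at x)"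
  shows "g differentiable (at x)"
proof -
  obtain D where "(f has_derivative D) (at x)"
    using assms(4) by (auto simp: differentiable_def)
  then have "(g has_derivative D) (at x)"
    by (rule has_derivative_transform_within_open[OF _ assms(1-3)])
  then show ?thesis
    by (auto simp: differentiable_def)
qed

text \<open>On an open set \<open>partial\<close> sees only values inside the set. Inductions can
  thus replace a partial derivative by a formula, such as the product rule, that is known on
  \<open>S\<close> alone.\<close>

lemma Ck_on_cong:
  assumes "open S" "\<And>y. y \<in> S \<Longrightarrow> f y = g y" "Ck_on k S f"
  shows "Ck_on k S g"
  using assms(2,3)
proof (induction k arbitrary: f g)
  case 0
  then show ?case by (auto intro: continuous_on_eq[of S f])
next
  case (Suc k)
  have "Ck_on k S (partial \<alpha> g)" for \<alpha>
  proof (rule Suc.IH)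
    show "partial \<alpha> f y = partial \<alpha> g y" if "y \<in> S" for y
      by (rule partial_cong[OF assms(1) that Suc.prems(1)])
    show "Ck_on k S (partial \<alpha> f)"
      using Suc.prems(2) by simp
  qed
  moreover have "g differentiable (at x)" if "x \<in> S" for x
    by (rule differentiable_cong[OF assms(1) that Suc.prems(1)]) (use Suc.prems(2) that in auto)
  ultimately show ?case
    by simp
qed

section \<open>Closure properties of the classes of k times continuously differentiable
  functions\<close>

lemma Ck_on_mono: "Ck_on k S f \<Longrightarrow> T \<subseteq> S \<Longrightarrow> Ck_on k T f"
  by (induction k arbitrary: f) (auto intro: continuous_on_subset)

lemma Ck_on_Suc_imp: "Ck_on (Suc k) S f \<Longrightarrow> Ck_on k S f"
proof (induction k arbitrary: f)
  case 0
  then show ?case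
    by (auto intro!: continuous_at_imp_continuous_on differentiable_imp_continuous_within)
qed auto

text \<open>Used for gluing: \<Omega> and the complement of a compact subset of it are open and
  cover the whole space.\<close>

lemma Ck_on_Un:
  assumes "open S" "open T"
  shows "Ck_on k S f \<Longrightarrow> Ck_on k T f \<Longrightarrow> Ck_on k (S \<union> T) f"
  by (induction k arbitrary: f) (use assms in \<open>auto intro: continuous_on_open_Un\<close>)

lemma Ck_on_const: "Ck_on k S (\<lambda>_. c)"
  by (induction k arbitrary: c) auto

lemma Ck_on_add:
  assumes "open S"
  shows "Ck_on k S f \<Longrightarrow> Ck_on k S g \<Longrightarrow> Ck_on k S (\<lambda>x. f x + g x)"
proof (induction k arbitrary: f g)
  case 0
  then show ?case by (auto intro: continuous_on_add)
next
  case (Suc k)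
  have "Ck_on k S (partial \<alpha> (\<lambda>x. f x + g x))" for \<alpha>
    by (rule Ck_on_cong[OF assms _ Suc.IH[of "partial \<alpha> f" "partial \<alpha> g"]])
      (use Suc.prems in \<open>auto simp: partial_add\<close>)
  then show ?case
    using Suc.prems by auto
qed

text \<open>The product rule yields two terms of the same shape, so the induction closes; the
  undifferentiated factor is weakened by \<open>Ck_on_Suc_imp\<close>. Real products, scalar
  multiples and inner products are all instances.\<close>

lemma Ck_on_bilinear:
  assumes "open S" "bounded_bilinear B"
  shows "Ck_on k S f \<Longrightarrow> Ck_on k S g \<Longrightarrow> Ck_on k S (\<lambda>x. B (f x) (g x))"
proof (induction k arbitrary: f g)
  case 0
  then show ?case by (auto intro: bounded_bilinear.continuous_on[OF assms(2)])
next
  case (Suc k)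
  have "Ck_on k S (partial \<alpha> (\<lambda>x. B (f x) (g x)))" for \<alpha>
  proof (rule Ck_on_cong[OF assms(1)])
    show "Ck_on k S (\<lambda>x. B (f x) (partial \<alpha> g x) + B (partial \<alpha> f x) (g x))"
      using Suc.prems Suc.prems[THEN Ck_on_Suc_imp] by (intro Ck_on_add[OF assms(1)] Suc.IH) auto
  qed (use Suc.prems in \<open>auto simp: partial_bilinear[OF assms(2)]\<close>)
  moreover have "(\<lambda>x. B (f x) (g x)) differentiable (at x)" if "x \<in> S" for x
  proof -
    obtain D E where "(f has_derivative D) (at x)" "(g has_derivative E) (at x)"
      using Suc.prems \<open>x \<in> S\<close> unfolding Ck_on.simps differentiable_def by blast
    then show ?thesis
      using bounded_bilinear.FDERIV[OF assms(2)] differentiable_def by blast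
  qed
  ultimately show ?case
    by auto
qed

lemma Ck_on_linear:
  assumes "open S" "bounded_linear T"
  shows "Ck_on k S f \<Longrightarrow> Ck_on k S (\<lambda>x. T (f x))"
proof (induction k arbitrary: f)
  case 0
  then show ?case by (auto intro: bounded_linear.continuous_on[OF assms(2)])
next
  case (Suc k)
  have "Ck_on k S (partial \<alpha> (\<lambda>x. T (f x)))" for \<alpha>
    by (rule Ck_on_cong[OF assms(1) _ Suc.IH[of "partial \<alpha> f"]])
      (use Suc.prems in \<open>auto simp: partial_linear[OF assms(2)]\<close>)
  moreover have "(\<lambda>x. T (f x)) differentiable (at x)" if "x \<in> S" for x
    using Suc.prems that bounded_linear.has_derivative[OF assms(2)]
    unfolding Ck_on.simps differentiable_def by blast
  ultimately show ?case
    by auto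
qed

lemma Ck_on_id: "Ck_on k UNIV (\<lambda>x. x)"
proof (cases k)
  case (Suc l)
  have "partial \<alpha> (\<lambda>x. x) = (\<lambda>_. axis \<alpha> 1)" for \<alpha>
    by (simp add: fun_eq_iff has_derivative_imp_partial[OF has_derivative_ident])
  then show ?thesis
    by (simp add: Suc Ck_on_const)
qed auto

section \<open>Test functions\<close>

text \<open>\<open>flat 1\<close> is the standard \<open>exp (- 1 / t)\<close>; the polynomials make the family closed under derivatives.\<close>

definition flat :: "real poly \<Rightarrow> real \<Rightarrow> real" where
  "flat p t = (if t > 0 then poly p (1 / t) * exp (- 1 / t) else 0)"

lemma poly_div_exp_tendsto_0: "((\<lambda>x::real. poly p x * exp (- x)) \<longlongrightarrow> 0) at_top"
proof -
  have "((\<lambda>x::real. coeff p i * (x ^ i / exp x)) \<longlongrightarrow> coeff p i * 0) at_top" for i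
    by (intro tendsto_mult tendsto_const tendsto_power_div_exp_0)
  then have "((\<lambda>x::real. \<Sum>i\<le>degree p. coeff p i * (x ^ i / exp x)) \<longlongrightarrow> (\<Sum>i\<le>degree p. 0)) at_top"
    by (intro tendsto_sum) simp
  then show ?thesis
    by (simp add: poly_altdef sum_distrib_right exp_minus field_simps sum_divide_distrib)
qed

lemma flat_tendsto_0: "(flat p \<longlongrightarrow> 0) (at_right 0)"
proof -
  have "((\<lambda>t::real. poly p (inverse t) * exp (- inverse t)) \<longlongrightarrow> 0) (at_right 0)"
    by (rule filterlim_compose[OF poly_div_exp_tendsto_0 filterlim_inverse_at_top_right])
  moreover have "\<forall>\<^sub>F t in at_right 0. poly p (inverse t) * exp (- inverse t) = flat p t"
    by (auto simp: eventually_at_filter flat_def inverse_eq_divide)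
  ultimately show ?thesis
    by (rule Lim_transform_eventually)
qed

text \<open>With u = 1/t, the derivative of p(u) exp(-u) in t is u^2 (p(u) - p'(u)) exp(-u), which
  gives the new polynomial. At 0 both one-sided difference quotients tend to 0.\<close>

lemma flat_has_derivative:
  "(flat p has_real_derivative flat ([:0, 0, 1:] * (p - pderiv p)) t) (at t)"
proof (cases t "0::real" rule: linorder_cases)
  case less
  have "((\<lambda>_. 0) has_real_derivative flat ([:0, 0, 1:] * (p - pderiv p)) t) (at t)"
    using less by (simp add: flat_def)
  then show ?thesis
    by (rule has_field_derivative_transform_within_open[of _ _ _ "{..<0}"]) (use less in \<open>auto simp: flat_def\<close>)
next
  case greater
  have "((\<lambda>t. poly p (1 / t) * exp (- 1 / t)) has_real_derivative
      flat ([:0, 0, 1:] * (p - pderiv p)) t) (at t)"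
    using greater
    by (auto intro!: derivative_eq_intros poly_DERIV[THEN DERIV_chain2]
        simp: flat_def field_simps power2_eq_square)
  then show ?thesis
    by (rule has_field_derivative_transform_within_open[of _ _ _ "{0<..}"]) (use greater in \<open>auto simp: flat_def\<close>)
next
  case equal
  have "((\<lambda>h. flat p h / h) \<longlongrightarrow> 0) (at_right 0)"
    \<comment> \<open>For h > 0, dividing by h multiplies the polynomial by its variable 1/h, so the
      quotient is again a flat function.\<close>
    by (rule Lim_transform_eventually[OF flat_tendsto_0[of "pCons 0 p"]])
      (auto simp: eventually_at_filter flat_def)
  moreover have "((\<lambda>h. flat p h / h) \<longlongrightarrow> 0) (at_left 0)"
    by (rule Lim_transform_eventually[OF tendsto_const])
      (auto simp: eventually_at_filter flat_def)
  ultimately have "((\<lambda>h. flat p h / h) \<longlongrightarrow> 0) (at 0)"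
    using filterlim_split_at by blast
  then show ?thesis
    using equal by (simp add: DERIV_def flat_def)
qed

text \<open>Differentiation changes the polynomial, hence the induction is over all \<open>p\<close>
  at once.\<close>

lemma Ck_on_flat:
  assumes "open S"
  shows "Ck_on k S w \<Longrightarrow> Ck_on k S (\<lambda>x. flat p (w x))"
proof (induction k arbitrary: p)
  case 0
  have "continuous_on UNIV (flat p)"
    by (intro continuous_at_imp_continuous_on ballI DERIV_isCont[OF flat_has_derivative])
  with 0 show ?case
    by (auto intro: continuous_on_compose2)
next
  case (Suc k)
  define q where "q = [:0, 0, 1:] * (p - pderiv p)"
  have D: "((\<lambda>x. flat p (w x)) has_derivative (\<lambda>h. flat q (w x) * D h)) (at x)"
    if "(w has_derivative D) (at x)" for x D
    using has_derivative_compose[OF that, of "flat p" "(*) (flat q (w x))"] flat_has_derivative[of p "w x"]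
    by (simp add: q_def has_field_derivative_def)
  have "Ck_on k S (partial \<alpha> (\<lambda>x. flat p (w x)))" for \<alpha>
  proof (rule Ck_on_cong[OF assms])
    show "Ck_on k S (\<lambda>x. flat q (w x) * partial \<alpha> w x)"
      using Suc.prems Suc.prems[THEN Ck_on_Suc_imp]
      by (intro Ck_on_bilinear[OF assms bounded_bilinear_mult] Suc.IH) auto
    show "flat q (w x) * partial \<alpha> w x = partial \<alpha> (\<lambda>x. flat p (w x)) x" if "x \<in> S" for x
    proof -
      obtain E where "(w has_derivative E) (at x)"
        using Suc.prems \<open>x \<in> S\<close> by (auto simp: differentiable_def)
      then show ?thesis
        using has_derivative_imp_partial D by metis
    qed
  qed
  moreover have "(\<lambda>x. flat p (w x)) differentiable (at x)" if "x \<in> S" for x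
    using Suc.prems that D unfolding Ck_on.simps differentiable_def by blast
  ultimately show ?case
    by auto
qed

section \<open>Bump functions and the fundamental lemma\<close>

lemma smooth_on_imp_differentiable: "smooth_on S f \<Longrightarrow> x \<in> S \<Longrightarrow> f differentiable (at x)"
  unfolding smooth_on_def by (drule spec[of _ "Suc 0"]) simp

lemma smooth_on_imp_continuous_on: "smooth_on S f \<Longrightarrow> continuous_on S f"
  unfolding smooth_on_def by (drule spec[of _ 0]) simp

lemma smooth_on_imp_continuous_on_partial: "smooth_on S f \<Longrightarrow> continuous_on S (partial \<alpha> f)"
  unfolding smooth_on_def by (drule spec[of _ "Suc 0"]) simp

lemma bump_function:
  assumes "e > 0"
  obtains h :: "real ^ 3 \<Rightarrow> real"
  where "smooth_on UNIV h" "\<And>x. h x \<ge> 0" "\<And>x. h x \<noteq> 0 \<longleftrightarrow> x \<in> ball a e"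
proof
  \<comment> \<open>This is e^2 - |x - a|^2, positive exactly on the ball; sums and multiples
    replace differences so that the closure rules apply directly.\<close>
  define w :: "real ^ 3 \<Rightarrow> real" where "w = (\<lambda>x. e\<^sup>2 + (- 1) * ((x + - a) \<bullet> (x + - a)))"
  have "Ck_on k UNIV w" for k
    unfolding w_def
    by (intro Ck_on_add[OF open_UNIV] Ck_on_const Ck_on_bilinear[OF open_UNIV bounded_bilinear_inner]
        Ck_on_linear[OF open_UNIV bounded_linear_mult_right] Ck_on_id)
  then show "smooth_on UNIV (\<lambda>x. flat 1 (w x))"
    unfolding smooth_on_def by (intro allI Ck_on_flat[OF open_UNIV])
  show "flat 1 (w x) \<ge> 0" for x
    by (simp add: flat_def)
  have "w x > 0 \<longleftrightarrow> dist a x < e" for x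
    using assms power_less_imp_less_base[of "norm (x - a)" 2 e] power_strict_mono[of "norm (x - a)" e 2]
    by (auto simp: w_def dist_norm norm_minus_commute[of a] power2_norm_eq_inner)
  then show "flat 1 (w x) \<noteq> 0 \<longleftrightarrow> x \<in> ball a e" for x
    by (auto simp: flat_def)
qed

text \<open>Nothing is known about \<open>f\<close> outside \<Omega>, but there the product vanishes
  identically near every point, since the support of \<open>h\<close> is a closed subset of
  \<Omega>.\<close>

lemma test_field_scaleR:
  assumes "open \<Omega>" "test_field \<Omega> h" "smooth_on \<Omega> f"
  shows "test_field \<Omega> (\<lambda>x. h x *\<^sub>R f x)"
proof -
  let ?K = "closure {x. h x \<noteq> 0}" and ?L = "closure {x. h x *\<^sub>R f x \<noteq> 0}"
  have h: "smooth_on UNIV h" "compact ?K" "?K \<subseteq> \<Omega>"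
    using assms(2) by (auto simp: test_field_def)
  have L: "?L \<subseteq> ?K"
    by (intro closure_mono) auto
  have "Ck_on k (\<Omega> \<union> - ?K) (\<lambda>x. h x *\<^sub>R f x)" for k
  proof (rule Ck_on_Un)
    show "Ck_on k \<Omega> (\<lambda>x. h x *\<^sub>R f x)"
      using h(1) assms(3) Ck_on_mono[of k UNIV h]
      by (intro Ck_on_bilinear[OF assms(1) bounded_bilinear_scaleR]) (auto simp: smooth_on_def)
    show "Ck_on k (- ?K) (\<lambda>x. h x *\<^sub>R f x)"
      by (rule Ck_on_cong[OF _ _ Ck_on_const[of _ _ 0]]) (use closure_subset[of "{x. h x \<noteq> 0}"] in auto)
  qed (use assms(1) in auto)
  moreover have "\<Omega> \<union> - ?K = UNIV"
    using h(3) by auto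
  moreover have "compact ?L"
    using compact_Int_closed[OF h(2), of ?L] L by (simp add: Int_absorb1)
  ultimately show ?thesis
    using L h(3) by (auto simp: test_field_def smooth_on_def)
qed

text \<open>If \<open>g a\<close> were nonzero, a nonnegative bump supported where \<open>g\<close>
  keeps the sign of \<open>g a\<close> would give a nonzero integral.\<close>

lemma fundamental_lemma_calculus_of_variations:
  fixes g :: "real ^ 3 \<Rightarrow> real"
  assumes "open \<Omega>" "continuous_on \<Omega> g"
    and int: "\<And>h. test_field \<Omega> h \<Longrightarrow> ((\<lambda>x. h x * g x) has_integral 0) \<Omega>"
    and "a \<in> \<Omega>"
  shows "g a = 0"
proof (rule ccontr)
  assume "g a \<noteq> 0"
  \<comment> \<open>The factor \<open>g a\<close> makes the function positive near \<open>a\<close>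
    whichever sign \<open>g a\<close> has.\<close>
  define f where "f = (\<lambda>x. g a * g x)"
  have f: "continuous_on \<Omega> f"
    unfolding f_def by (intro continuous_intros assms)
  have "f a > 0"
    using \<open>g a \<noteq> 0\<close> by (auto simp: f_def zero_less_mult_iff)
  moreover have "open (f -` {0<..} \<inter> \<Omega>)"
    using f assms(1) by (simp add: continuous_on_open_vimage)
  moreover have "a \<in> f -` {0<..} \<inter> \<Omega>"
    using \<open>f a > 0\<close> assms(4) by simp
  ultimately obtain e where e: "e > 0" "cball a e \<subseteq> f -` {0<..} \<inter> \<Omega>"
    using assms(4) unfolding open_contains_cball by blast
  obtain h :: "real ^ 3 \<Rightarrow> real" where h: "smooth_on UNIV h" "\<And>x. h x \<ge> 0" "\<And>x. h x \<noteq> 0 \<longleftrightarrow> x \<in> ball a e"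
    using bump_function[OF e(1)] by metis
  have "{x. h x \<noteq> 0} = ball a e"
    using h(3) by blast
  then have "closure {x. h x \<noteq> 0} = cball a e"
    using e(1) by simp
  then have "test_field \<Omega> h"
    using h(1) e(2) by (auto simp: test_field_def)
  from has_integral_mult_right[OF int[OF this], of "g a"]
  have F: "((\<lambda>x. h x * f x) has_integral 0) \<Omega>"
    by (simp add: f_def mult.left_commute)
  have nonneg: "h x * f x \<ge> 0" for x
    using h(2)[of x] h(3)[of x] e(2) by (cases "x \<in> ball a e") (auto intro!: mult_nonneg_nonneg less_imp_le)
  \<comment> \<open>The integrand is nonnegative, so its zero integral over \<Omega> passes to a box
    around \<open>a\<close>; there continuity forces it to vanish pointwise.\<close>
  obtain u v where uv: "cbox u v \<subseteq> ball a e" "a \<in> box u v"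
    using open_contains_cbox[of "ball a e" a] e(1) by (metis centre_in_ball open_ball)
  have sub: "cbox u v \<subseteq> \<Omega>"
    using uv(1) e(2) ball_subset_cball[of a e] by blast
  have cont: "continuous_on (cbox u v) (\<lambda>x. h x * f x)"
    using sub by (intro continuous_on_mult continuous_on_subset[OF f]
        continuous_on_subset[OF smooth_on_imp_continuous_on[OF h(1)]]) auto
  have "integral (cbox u v) (\<lambda>x. h x * f x) \<le> integral \<Omega> (\<lambda>x. h x * f x)"
    using sub F nonneg
    by (intro integral_subset_le integrable_continuous cont) (auto simp: has_integral_integrable)
  moreover have "integral (cbox u v) (\<lambda>x. h x * f x) \<ge> 0"
    by (intro integral_nonneg integrable_continuous cont nonneg)
  ultimately have "integral (cbox u v) (\<lambda>x. h x * f x) = 0"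
    using F by (simp add: integral_unique)
  then have "((\<lambda>x. h x * f x) has_integral 0) (cbox u v)"
    using integrable_integral[OF integrable_continuous[OF cont]] by simp
  then have "h a * f a = 0"
    using uv(2) nonneg box_subset_cbox[of u v] by (intro has_integral_0_cbox_imp_0[OF cont]) auto
  then show False
    using \<open>f a > 0\<close> h(3)[of a] e(1) by simp
qed

section \<open>Integrals of divergences\<close>

lemma has_integral_vanishing_outside:
  fixes f :: "'n::euclidean_space \<Rightarrow> 'a::banach"
  assumes "(f has_integral i) S" "\<And>x. x \<notin> S \<inter> T \<Longrightarrow> f x = 0"
  shows "(f has_integral i) T"
proof -
  have "(f has_integral i) UNIV"
    using assms by (auto intro: has_integral_on_superset)
  moreover have "(\<lambda>x. if x \<in> T then f x else 0) = f"
    using assms(2) by auto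
  ultimately show ?thesis
    using has_integral_restrict_UNIV[of T f i] by simp
qed

text \<open>The integral of a compactly supported function is invariant under translation.
  Differentiating the translated integral at 0 under the integral sign gives the integral of the
  partial derivative, which is therefore 0.\<close>

lemma has_integral_partial_0:
  fixes W :: "real ^ 3 \<Rightarrow> real"
  assumes "open \<Omega>" "Ck_on 1 \<Omega> W" "compact K" "K \<subseteq> \<Omega>" and W0: "\<And>x. x \<notin> K \<Longrightarrow> W x = 0"
  shows "(partial \<alpha> W has_integral 0) \<Omega>"
proof -
  define e :: "real ^ 3" where "e = axis \<alpha> 1"
  have "Ck_on 1 (- K) W"
    by (rule Ck_on_cong[OF _ _ Ck_on_const[of 1 "- K" 0]])
      (use assms(3) W0 in \<open>auto simp: open_Compl compact_imp_closed\<close>)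
  then have "Ck_on 1 (\<Omega> \<union> - K) W"
    using assms(1,3) by (intro Ck_on_Un assms(2)) (auto simp: open_Compl compact_imp_closed)
  moreover have "\<Omega> \<union> - K = UNIV"
    using assms(4) by auto
  ultimately have W: "W differentiable (at x)" "continuous_on UNIV (partial \<alpha> W)" for x
    by simp_all
  have contW: "continuous_on UNIV W"
    by (intro continuous_at_imp_continuous_on ballI differentiable_imp_continuous_within W(1))
  have pW0: "partial \<alpha> W x = 0" if "x \<notin> K" for x
  proof -
    have "partial \<alpha> W x = partial \<alpha> (\<lambda>_. 0 :: real) x"
      using that assms(3) W0 by (intro partial_cong[of "- K"]) (auto simp: open_Compl compact_imp_closed)
    then show ?thesis by simp
  qed
  \<comment> \<open>The set swept out by \<open>K\<close> under shifts of length at most 1; a box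
    containing it contains the supports of all shifted copies of \<open>W\<close>.\<close>
  define K' where "K' = (\<lambda>(x, t). x + (- t) *\<^sub>R e) ` (K \<times> {-1..1})"
  have "compact K'"
    unfolding K'_def split_def
    by (rule compact_continuous_image) (auto intro!: compact_Times assms(3) continuous_intros)
  then obtain d where d: "K' \<subseteq> cbox (- d) d"
    using bounded_subset_cbox_symmetric[OF compact_imp_bounded] by blast
  have mem: "x \<in> cbox (- d) d" if "x + t *\<^sub>R e \<in> K" "t \<in> {-1..1}" for x t
  proof -
    have "(\<lambda>(x, t). x + (- t) *\<^sub>R e) (x + t *\<^sub>R e, t) \<in> K'"
      unfolding K'_def using that by (intro imageI) simp
    then show ?thesis using d by auto
  qed
  have "W integrable_on cbox (- d) d"
    by (intro integrable_continuous continuous_on_subset[OF contW]) auto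
  then have I: "(W has_integral integral (cbox (- d) d) W) (cbox (- d) d)"
    by (rule integrable_integral)
  have shift: "((\<lambda>x. W (x + t *\<^sub>R e)) has_integral integral (cbox (- d) d) W) (cbox (- d) d)"
    if "t \<in> {-1..1}" for t
  \<comment> \<open>The change of variables also moves the box; both the moved and the original box
    contain the support of the shifted function, so either may be the domain.\<close>
  proof (rule has_integral_vanishing_outside[OF has_integral_shift_cbox[OF I, of "t *\<^sub>R e"]])
    fix x assume x: "x \<notin> cbox (- d - t *\<^sub>R e) (d - t *\<^sub>R e) \<inter> cbox (- d) d"
    show "W (x + t *\<^sub>R e) = 0"
    proof (rule W0, rule notI)
      assume *: "x + t *\<^sub>R e \<in> K"
      then have "x + t *\<^sub>R e \<in> cbox (- d) d"
        using mem[of "x + t *\<^sub>R e" 0] by simp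
      then have "x \<in> cbox (- d - t *\<^sub>R e) (d - t *\<^sub>R e)"
        by (auto simp: mem_box algebra_simps)
      with x mem[OF * that] show False by blast
    qed
  qed
  have "((\<lambda>t. integral (cbox (- d) d) (\<lambda>x. W (x + t *\<^sub>R e))) has_vector_derivative
      integral (cbox (- d) d) (\<lambda>x. partial \<alpha> W (x + 0 *\<^sub>R e))) (at 0 within {-1<..<1})"
  proof (rule leibniz_rule_vector_derivative)
    show "((\<lambda>t. W (x + t *\<^sub>R e)) has_vector_derivative partial \<alpha> W (x + t *\<^sub>R e)) (at t within {-1<..<1})"
      for t x
      unfolding e_def by (intro partial_has_vector_derivative W)
    show "(\<lambda>x. W (x + t *\<^sub>R e)) integrable_on cbox (- d) d" if "t \<in> {-1<..<1}" for t
      using shift[of t] that by (auto simp: has_integral_integrable)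
    show "continuous_on ({- 1<..<1} \<times> cbox (- d) d) (\<lambda>(t, x). partial \<alpha> W (x + t *\<^sub>R e))"
      unfolding split_def
      by (rule continuous_on_compose2[OF W(2)]) (auto intro!: continuous_intros)
  qed auto
  then have "((\<lambda>t. integral (cbox (- d) d) (\<lambda>x. W (x + t *\<^sub>R e))) has_vector_derivative
      integral (cbox (- d) d) (partial \<alpha> W)) (at 0)"
    by (simp add: at_within_open[of 0 "{-1<..<1::real}"])
  moreover have "((\<lambda>t. integral (cbox (- d) d) (\<lambda>x. W (x + t *\<^sub>R e))) has_vector_derivative 0) (at 0)"
  proof (rule has_vector_derivative_transform_within_open)
    show "((\<lambda>_. integral (cbox (- d) d) W) has_vector_derivative 0) (at 0)"
      by (rule has_vector_derivative_const)
    show "integral (cbox (- d) d) W = integral (cbox (- d) d) (\<lambda>x. W (x + t *\<^sub>R e))"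
      if "t \<in> {-1<..<1}" for t
      using shift[of t] that by (simp add: integral_unique)
  qed auto
  ultimately have "integral (cbox (- d) d) (partial \<alpha> W) = 0"
    by (rule vector_derivative_unique_at)
  moreover have "partial \<alpha> W integrable_on cbox (- d) d"
    by (intro integrable_continuous continuous_on_subset[OF W(2)]) auto
  ultimately have "(partial \<alpha> W has_integral 0) (cbox (- d) d)"
    by (simp add: has_integral_iff)
  then show ?thesis
    by (rule has_integral_vanishing_outside)
      (use assms(4) mem[of _ 0] pW0 in force)
qed

section \<open>Spinor algebra and the first variation\<close>

abbreviation sigma3 :: "complex ^ 2 \<Rightarrow> complex ^ 2" where
  "sigma3 v \<equiv> pauli 3 *v v"

abbreviation isigma :: "3 \<Rightarrow> complex ^ 2 \<Rightarrow> complex ^ 2" where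
  "isigma \<alpha> v \<equiv> \<i> *s (sigma_up \<alpha> *v v)"

definition massless_dirac ::
  "real \<Rightarrow> (real ^ 3 \<Rightarrow> real ^ 3) \<Rightarrow> (real ^ 3 \<Rightarrow> complex ^ 2) \<Rightarrow> real ^ 3 \<Rightarrow> complex ^ 2" where
  "massless_dirac r A \<eta> x =
    (\<Sum>\<alpha>\<in>UNIV. isigma \<alpha> (partial \<alpha> \<eta> x) + (r * A x $ \<alpha>) *\<^sub>R (sigma_up \<alpha> *v \<eta> x))"

lemma sum_UNIV_3: "sum f (UNIV :: 3 set) = f 1 + f 2 + f 0"
proof -
  have "(3 :: 3) = 0" by simp
  then show ?thesis by (metis sum_3)
qed

section \<open>Pauli matrices and the real inner product\<close>

lemma bounded_linear_matrix_vector: "bounded_linear (\<lambda>v::complex ^ 2. (M :: complex ^ 2 ^ 2) *v v)"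
  unfolding linear_conv_bounded_linear[symmetric]
  by (rule linearI)
    (auto simp: vec_eq_iff matrix_vector_mult_def sum_2 algebra_simps)

lemma bounded_linear_isigma: "bounded_linear (isigma \<alpha>)"
  unfolding linear_conv_bounded_linear[symmetric]
  by (rule linearI)
    (auto simp: vec_eq_iff matrix_vector_mult_def sum_2 algebra_simps)

lemma scaleR_imaginary_unit: "\<i> *s (t *\<^sub>R v) = t *\<^sub>R (\<i> *s v)"
  by (simp add: vec_eq_iff)

text \<open>The real inner product is the real part of the Hermitian one, and the matrices are
  Hermitian; the factor i turns symmetry into skewness.\<close>

lemma inner_isigma: "u \<bullet> isigma \<alpha> v = - (isigma \<alpha> u \<bullet> v)"
  by (auto simp: inner_vec_def inner_complex_def matrix_vector_mult_def sum_2 sigma_up_def pauli_def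
      algebra_simps)

lemma inner_sigma_up: "u \<bullet> (sigma_up \<alpha> *v v) = (sigma_up \<alpha> *v u) \<bullet> v"
  by (auto simp: inner_vec_def inner_complex_def matrix_vector_mult_def sum_2 sigma_up_def pauli_def
      algebra_simps)

lemma inner_sigma3: "u \<bullet> sigma3 v = sigma3 u \<bullet> v"
  by (auto simp: inner_vec_def inner_complex_def matrix_vector_mult_def sum_2 pauli_def
      algebra_simps)

lemma Re_sigma3_form: "Re (sigma3_form v) = v \<bullet> sigma3 v"
  by (simp add: sigma3_form_def inner_vec_def inner_complex_def matrix_vector_mult_def sum_2 pauli_def
      algebra_simps)

lemma partial_component:
  assumes "\<eta> differentiable (at x)"
  shows "partial \<alpha> (\<lambda>y. \<eta> y $ b) x = partial \<alpha> \<eta> x $ b"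
  by (rule partial_linear[OF bounded_linear_vec_nth assms])

lemma dirac_eq:
  assumes "\<eta> differentiable (at x)"
  shows "dirac r s m A \<eta> x = massless_dirac r A \<eta> x + (s * m) *\<^sub>R sigma3 (\<eta> x)"
  by (simp add: vec_eq_iff dirac_def massless_dirac_def partial_component[OF assms] sum_UNIV_3 sum_2
      matrix_vector_mult_def scaleR_conv_of_real[where 'a = complex] algebra_simps)

text \<open>By hermiticity the second sum in \<open>kinetic_form\<close> is minus the conjugate of
  the first, so half the difference is the real part of the first sum.\<close>

lemma Re_kinetic_form:
  assumes "\<eta> differentiable (at x)"
  shows "Re (kinetic_form r A \<eta> x) = \<eta> x \<bullet> massless_dirac r A \<eta> x"
  by (simp add: kinetic_form_def massless_dirac_def partial_cnj[OF assms] partial_component[OF assms]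
      sum_UNIV_3 sum_2 inner_vec_def inner_complex_def matrix_vector_mult_def sigma_up_def pauli_def
      algebra_simps add_divide_distrib diff_divide_distrib)

lemma massless_dirac_add_scaleR:
  assumes "\<eta> differentiable (at x)" "\<phi> differentiable (at x)"
  shows "massless_dirac r A (\<lambda>y. \<eta> y + t *\<^sub>R \<phi> y) x =
    massless_dirac r A \<eta> x + t *\<^sub>R massless_dirac r A \<phi> x"
proof -
  have "(\<lambda>y. t *\<^sub>R \<phi> y) differentiable (at x)"
    using assms(2) by simp
  then have "partial \<alpha> (\<lambda>y. \<eta> y + t *\<^sub>R \<phi> y) x = partial \<alpha> \<eta> x + t *\<^sub>R partial \<alpha> \<phi> x" for \<alpha>
    using partial_add[OF assms(1)] partial_linear[OF bounded_linear_scaleR_right assms(2)] by metis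
  then show ?thesis
    by (simp add: massless_dirac_def sum.distrib scaleR_sum_right scaleR_add_right
        linear_add[OF bounded_linear.linear[OF bounded_linear_matrix_vector]]
        linear_add[OF bounded_linear.linear[OF bounded_linear_isigma]]
        linear_scale[OF bounded_linear.linear[OF bounded_linear_matrix_vector]]
        linear_scale[OF bounded_linear.linear[OF bounded_linear_isigma]] scaleR_imaginary_unit mult.commute)
qed

text \<open>Integration by parts in pointwise form: \<open>massless_dirac\<close> is symmetric up to a divergence.\<close>

lemma inner_massless_dirac:
  assumes "\<eta> differentiable (at x)" "\<phi> differentiable (at x)"
  shows "\<eta> x \<bullet> massless_dirac r A \<phi> x =
    \<phi> x \<bullet> massless_dirac r A \<eta> x + (\<Sum>\<alpha>\<in>UNIV. partial \<alpha> (\<lambda>y. \<eta> y \<bullet> isigma \<alpha> (\<phi> y)) x)"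
proof -
  have "partial \<alpha> (\<lambda>y. \<eta> y \<bullet> isigma \<alpha> (\<phi> y)) x =
      \<eta> x \<bullet> isigma \<alpha> (partial \<alpha> \<phi> x) - \<phi> x \<bullet> isigma \<alpha> (partial \<alpha> \<eta> x)" for \<alpha>
  proof -
    have "(\<lambda>y. isigma \<alpha> (\<phi> y)) differentiable (at x)"
      using assms(2) bounded_linear.has_derivative[OF bounded_linear_isigma]
      unfolding differentiable_def by blast
    then show ?thesis
      using partial_bilinear[OF bounded_bilinear_inner assms(1), of "\<lambda>y. isigma \<alpha> (\<phi> y)"]
      by (simp add: partial_linear[OF bounded_linear_isigma assms(2)] inner_isigma[of "partial \<alpha> \<eta> x"] inner_commute)
  qed
  moreover have "\<eta> x \<bullet> (sigma_up \<alpha> *v \<phi> x) = \<phi> x \<bullet> (sigma_up \<alpha> *v \<eta> x)" for \<alpha>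
    by (metis inner_commute inner_sigma_up)
  ultimately show ?thesis
    by (simp add: massless_dirac_def inner_sum_right inner_add_right sum.distrib sum_subtractf)
qed

text \<open>Along the line through \<eta> in direction \<phi>, the kinetic form and the density are
  quadratic polynomials in t, so the Lagrangian is a rational function and the quotient rule applies
  at 0. Integration by parts moves the derivatives in the cross term off \<phi>.\<close>

lemma deriv_lagrangian:
  fixes r m :: real and A :: "real ^ 3 \<Rightarrow> real ^ 3" and \<eta> \<phi> :: "real ^ 3 \<Rightarrow> complex ^ 2"
  assumes "\<eta> differentiable (at x)" "\<phi> differentiable (at x)" "\<eta> x \<bullet> sigma3 (\<eta> x) > 0"
  defines "K \<equiv> \<eta> x \<bullet> massless_dirac r A \<eta> x" and "\<rho> \<equiv> \<eta> x \<bullet> sigma3 (\<eta> x)"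
    and "\<delta>K \<equiv> 2 * (\<phi> x \<bullet> massless_dirac r A \<eta> x) +
      (\<Sum>\<alpha>\<in>UNIV. partial \<alpha> (\<lambda>y. \<eta> y \<bullet> isigma \<alpha> (\<phi> y)) x)"
    and "\<delta>\<rho> \<equiv> 2 * (\<phi> x \<bullet> sigma3 (\<eta> x))"
  shows "deriv (\<lambda>t::real. lagrangian r m A (\<lambda>y. \<eta> y + t *\<^sub>R \<phi> y) x) 0 =
    - (16 / 9) * ((2 * K * \<delta>K - 2 * m\<^sup>2 * \<rho> * \<delta>\<rho>) / \<rho> - \<delta>\<rho> * (K\<^sup>2 - m\<^sup>2 * \<rho>\<^sup>2) / \<rho>\<^sup>2)"
proof (rule DERIV_imp_deriv)
  \<comment> \<open>The coefficients of t^2, which drop out of the derivative at 0.\<close>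
  define c where "c = \<phi> x \<bullet> massless_dirac r A \<phi> x"
  define d where "d = \<phi> x \<bullet> sigma3 (\<phi> x)"
  have "Re (kinetic_form r A (\<lambda>y. \<eta> y + t *\<^sub>R \<phi> y) x) = K + t * \<delta>K + t\<^sup>2 * c" for t
  proof -
    have "Re (kinetic_form r A (\<lambda>y. \<eta> y + t *\<^sub>R \<phi> y) x) =
        (\<eta> x + t *\<^sub>R \<phi> x) \<bullet> massless_dirac r A (\<lambda>y. \<eta> y + t *\<^sub>R \<phi> y) x"
      using assms(1,2) by (intro Re_kinetic_form) simp
    also have "\<dots> = K + t * \<delta>K + t\<^sup>2 * c"
      by (simp add: massless_dirac_add_scaleR[OF assms(1,2)] inner_massless_dirac[OF assms(1,2)]
          K_def \<delta>K_def c_def inner_add_left inner_add_right power2_eq_square algebra_simps)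
    finally show ?thesis .
  qed
  moreover have "Re (sigma3_form (\<eta> x + t *\<^sub>R \<phi> x)) = \<rho> + t * \<delta>\<rho> + t\<^sup>2 * d" for t
    by (simp add: Re_sigma3_form linear_add[OF bounded_linear.linear[OF bounded_linear_matrix_vector]]
        linear_scale[OF bounded_linear.linear[OF bounded_linear_matrix_vector]]
        inner_add_left inner_add_right inner_sigma3[of "\<eta> x" "\<phi> x"] inner_commute[of _ "\<phi> x"]
        \<rho>_def \<delta>\<rho>_def d_def power2_eq_square algebra_simps)
  ultimately have L: "lagrangian r m A (\<lambda>y. \<eta> y + t *\<^sub>R \<phi> y) x =
      - (16 / 9) * (((K + t * \<delta>K + t\<^sup>2 * c)\<^sup>2 - m\<^sup>2 * (\<rho> + t * \<delta>\<rho> + t\<^sup>2 * d)\<^sup>2) / (\<rho> + t * \<delta>\<rho> + t\<^sup>2 * d))" for t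
    by (simp add: lagrangian_def power_mult_distrib)
  have "\<rho> > 0"
    using assms(3) by (simp add: \<rho>_def)
  have N: "((\<lambda>t. (K + t * \<delta>K + t\<^sup>2 * c)\<^sup>2 - m\<^sup>2 * (\<rho> + t * \<delta>\<rho> + t\<^sup>2 * d)\<^sup>2) has_real_derivative
      2 * K * \<delta>K - 2 * m\<^sup>2 * \<rho> * \<delta>\<rho>) (at 0)"
    by (auto intro!: derivative_eq_intros)
  have R: "((\<lambda>t. \<rho> + t * \<delta>\<rho> + t\<^sup>2 * d) has_real_derivative \<delta>\<rho>) (at 0)"
    by (auto intro!: derivative_eq_intros)
  show "((\<lambda>t::real. lagrangian r m A (\<lambda>y. \<eta> y + t *\<^sub>R \<phi> y) x) has_real_derivative
    - (16 / 9) * ((2 * K * \<delta>K - 2 * m\<^sup>2 * \<rho> * \<delta>\<rho>) / \<rho> - \<delta>\<rho> * (K\<^sup>2 - m\<^sup>2 * \<rho>\<^sup>2) / \<rho>\<^sup>2)) (at 0)"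
    unfolding L
    by (rule DERIV_cong[OF DERIV_cmult[OF DERIV_divide[OF N R]]])
      (use \<open>\<rho> > 0\<close> in \<open>auto simp: diff_divide_distrib power2_eq_square\<close>)
qed

text \<open>A continuous function with finitely many values is constant on each ball in \<Omega>,
  balls being connected. This will apply to the sign of the mass term.\<close>

lemma finite_range_has_derivative:
  fixes s :: "real ^ 3 \<Rightarrow> real"
  assumes "open \<Omega>" "continuous_on \<Omega> s" "finite (s ` \<Omega>)" "x \<in> \<Omega>"
  shows "(s has_derivative (\<lambda>_. 0)) (at x)"
proof -
  obtain e where e: "e > 0" "ball x e \<subseteq> \<Omega>"
    using assms(1,4) open_contains_ball by blast
  have "s constant_on ball x e"
    using assms(2,3) e(2) finite_subset[OF image_mono]
    by (intro continuous_finite_range_constant) (auto intro: continuous_on_subset)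
  then have *: "s x = s y" if "y \<in> ball x e" for y
    using that e(1) by (auto simp: constant_on_def)
  show ?thesis
  proof (rule has_derivative_transform_within_open)
    show "((\<lambda>_. s x) has_derivative (\<lambda>_. 0)) (at x)"
      by simp
    show "open (ball x e)" "x \<in> ball x e" "\<And>y. y \<in> ball x e \<Longrightarrow> s x = s y"
      using e(1) * by auto
  qed
qed

lemma Ck_on_finite_range:
  fixes s :: "real ^ 3 \<Rightarrow> real"
  assumes "open \<Omega>" "continuous_on \<Omega> s" "finite (s ` \<Omega>)"
  shows "Ck_on k \<Omega> s"
proof (cases k)
  case (Suc l)
  note D = finite_range_has_derivative[OF assms]
  have "Ck_on l \<Omega> (partial \<alpha> s)" for \<alpha>
    by (rule Ck_on_cong[OF assms(1) _ Ck_on_const[of _ _ 0]]) (simp add: has_derivative_imp_partial[OF D])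
  then show ?thesis
    using D by (auto simp: Suc differentiable_def)
qed (use assms in simp)

lemma continuous_on_massless_dirac:
  assumes "smooth_on UNIV A" "smooth_on \<Omega> \<eta>"
  shows "continuous_on \<Omega> (massless_dirac r A \<eta>)"
  unfolding massless_dirac_def
  using smooth_on_imp_continuous_on[OF assms(2)] smooth_on_imp_continuous_on_partial[OF assms(2)]
    continuous_on_subset[OF smooth_on_imp_continuous_on[OF assms(1)]]
  by (intro continuous_intros bounded_linear.continuous_on[OF bounded_linear_isigma]
      bounded_linear.continuous_on[OF bounded_linear_matrix_vector]) auto

text \<open>The factor \<open>s\<close> has zero derivative, so it can be moved inside each partial
  derivative; what is integrated is then the divergence of a compactly supported field.\<close>

lemma has_integral_signed_divergence:
  fixes s :: "real ^ 3 \<Rightarrow> real"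
  assumes "open \<Omega>" "smooth_on \<Omega> \<eta>" "test_field \<Omega> \<phi>"
    and "continuous_on \<Omega> s" "finite (s ` \<Omega>)"
  shows "((\<lambda>x. s x * (\<Sum>\<alpha>\<in>UNIV. partial \<alpha> (\<lambda>y. \<eta> y \<bullet> isigma \<alpha> (\<phi> y)) x)) has_integral 0) \<Omega>"
proof -
  let ?K = "closure {x. \<phi> x \<noteq> 0}"
  have \<phi>: "smooth_on UNIV \<phi>" "compact ?K" "?K \<subseteq> \<Omega>"
    using assms(3) by (auto simp: test_field_def)
  have Ck: "Ck_on 1 \<Omega> \<eta>" "Ck_on 1 \<Omega> \<phi>" "Ck_on 1 \<Omega> s"
    using assms(2) \<phi>(1) Ck_on_mono[of 1 UNIV \<phi> \<Omega>] Ck_on_finite_range[OF assms(1,4,5)]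
    by (auto simp: smooth_on_def simp del: Ck_on.simps One_nat_def)
  have V: "Ck_on 1 \<Omega> (\<lambda>y. \<eta> y \<bullet> isigma \<alpha> (\<phi> y))" for \<alpha>
    by (intro Ck_on_bilinear[OF assms(1) bounded_bilinear_inner]
        Ck_on_linear[OF assms(1) bounded_linear_isigma] Ck)
  have int: "((\<lambda>x. s x * partial \<alpha> (\<lambda>y. \<eta> y \<bullet> isigma \<alpha> (\<phi> y)) x) has_integral 0) \<Omega>" for \<alpha>
  proof (rule has_integral_eq)
    show "(partial \<alpha> (\<lambda>y. s y * (\<eta> y \<bullet> isigma \<alpha> (\<phi> y))) has_integral 0) \<Omega>"
    proof (rule has_integral_partial_0[OF assms(1) _ \<phi>(2,3)])
      show "Ck_on 1 \<Omega> (\<lambda>y. s y * (\<eta> y \<bullet> isigma \<alpha> (\<phi> y)))"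
        by (rule Ck_on_bilinear[OF assms(1) bounded_bilinear_mult Ck(3) V])
      show "s x * (\<eta> x \<bullet> isigma \<alpha> (\<phi> x)) = 0" if "x \<notin> ?K" for x
      proof -
        have "\<phi> x = 0"
          using that closure_subset[of "{x. \<phi> x \<noteq> 0}"] by auto
        then show ?thesis by simp
      qed
    qed
    show "partial \<alpha> (\<lambda>y. s y * (\<eta> y \<bullet> isigma \<alpha> (\<phi> y))) x =
        s x * partial \<alpha> (\<lambda>y. \<eta> y \<bullet> isigma \<alpha> (\<phi> y)) x" if "x \<in> \<Omega>" for x
    proof -
      have s: "(s has_derivative (\<lambda>_. 0)) (at x)"
        by (rule finite_range_has_derivative[OF assms(1,4,5) that])
      have "s differentiable (at x)" "(\<lambda>y. \<eta> y \<bullet> isigma \<alpha> (\<phi> y)) differentiable (at x)"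
        using s V[of \<alpha>] that by (auto simp: differentiable_def)
      from partial_bilinear[OF bounded_bilinear_mult this] show ?thesis
        by (simp add: has_derivative_imp_partial[OF s])
    qed
  qed
  have "((\<lambda>x. \<Sum>\<alpha>\<in>UNIV. s x * partial \<alpha> (\<lambda>y. \<eta> y \<bullet> isigma \<alpha> (\<phi> y)) x) has_integral
      (\<Sum>\<alpha>\<in>(UNIV :: 3 set). 0)) \<Omega>"
    by (intro has_integral_sum int finite)
  then show ?thesis
    by (simp add: sum_distrib_left)
qed

lemma dirac_imp_massless_dirac:
  assumes "\<eta> differentiable (at x)" "dirac r \<sigma> m A \<eta> x = 0"
  shows "massless_dirac r A \<eta> x = - (\<sigma> * m) *\<^sub>R sigma3 (\<eta> x)"
  using assms by (simp add: dirac_eq add_eq_0_iff2)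

section \<open>Stationary spinor fields\<close>

text \<open>The charge sign \<open>r\<close> is a parameter, so that both Lagrangians are
  instances.\<close>

locale spinor_field =
  fixes r m :: real and \<Omega> :: "(real ^ 3) set" and A :: "real ^ 3 \<Rightarrow> real ^ 3" and \<eta> :: "real ^ 3 \<Rightarrow> complex ^ 2"
  assumes m: "m > 0" and open_domain: "open \<Omega>"
    and smooth_potential: "smooth_on UNIV A" and smooth_spinor: "smooth_on \<Omega> \<eta>"
    and density_pos: "\<And>x. x \<in> \<Omega> \<Longrightarrow> Re (sigma3_form (\<eta> x)) > 0"
begin

section \<open>Density, kinetic form and the sign of the mass term\<close>

definition density :: "real ^ 3 \<Rightarrow> real" where
  "density x = \<eta> x \<bullet> sigma3 (\<eta> x)"

definition kinetic :: "real ^ 3 \<Rightarrow> real" where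
  "kinetic x = \<eta> x \<bullet> massless_dirac r A \<eta> x"

definition mass_sign :: "real ^ 3 \<Rightarrow> real" where
  "mass_sign x = - kinetic x / (m * density x)"

lemma density_positive: "x \<in> \<Omega> \<Longrightarrow> density x > 0"
  using density_pos by (simp add: density_def Re_sigma3_form)

lemma differentiable: "x \<in> \<Omega> \<Longrightarrow> \<eta> differentiable (at x)"
  by (rule smooth_on_imp_differentiable[OF smooth_spinor])

lemma continuous_on_kinetic: "continuous_on \<Omega> kinetic"
  unfolding kinetic_def
  by (intro continuous_intros smooth_on_imp_continuous_on[OF smooth_spinor]
      continuous_on_massless_dirac[OF smooth_potential smooth_spinor])

lemma continuous_on_density: "continuous_on \<Omega> density"
  unfolding density_def
  by (intro continuous_intros bounded_linear.continuous_on[OF bounded_linear_matrix_vector]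
      smooth_on_imp_continuous_on[OF smooth_spinor])

lemma continuous_on_mass_sign: "continuous_on \<Omega> mass_sign"
  unfolding mass_sign_def
  using m density_positive by (intro continuous_intros continuous_on_kinetic continuous_on_density) force

lemma kinetic_eq: "x \<in> \<Omega> \<Longrightarrow> kinetic x = - (mass_sign x * m * density x)"
  using m density_positive[of x] by (simp add: mass_sign_def)

text \<open>Pairing the Dirac equation with \<eta> gives kinetic form = - \<sigma> m density, and m
  times the density is positive. In particular the two Dirac equations exclude each other at every
  point.\<close>

lemma mass_sign_eq:
  assumes "x \<in> \<Omega>" "dirac r \<sigma> m A \<eta> x = 0"
  shows "mass_sign x = \<sigma>"
  using m density_positive[OF assms(1)] dirac_imp_massless_dirac[OF differentiable[OF assms(1)] assms(2)]
  by (simp add: mass_sign_def kinetic_def density_def)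

lemma deriv_lagrangian_eq:
  assumes "x \<in> \<Omega>" "\<phi> differentiable (at x)"
  shows "deriv (\<lambda>t::real. lagrangian r m A (\<lambda>y. \<eta> y + t *\<^sub>R \<phi> y) x) 0 =
    - (16 / 9) * ((2 * kinetic x * (2 * (\<phi> x \<bullet> massless_dirac r A \<eta> x) +
      (\<Sum>\<alpha>\<in>UNIV. partial \<alpha> (\<lambda>y. \<eta> y \<bullet> isigma \<alpha> (\<phi> y)) x)) - 4 * m\<^sup>2 * density x * (\<phi> x \<bullet> sigma3 (\<eta> x))) / density x
      - 2 * (\<phi> x \<bullet> sigma3 (\<eta> x)) * ((kinetic x)\<^sup>2 - m\<^sup>2 * (density x)\<^sup>2) / (density x)\<^sup>2)"
  using deriv_lagrangian[OF differentiable[OF assms(1)] assms(2), where r = r and A = A and m = m] density_positive[OF assms(1)]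
  by (simp add: density_def kinetic_def mult.assoc)

text \<open>Real rescalings of the spinor rescale the Lagrangian, so a stationary point has zero Lagrangian.\<close>

lemma mass_sign_square:
  assumes "field_equation \<Omega> (lagrangian r m A) \<eta>" "x \<in> \<Omega>"
  shows "(mass_sign x)\<^sup>2 = 1"
proof -
  define g where "g x = ((kinetic x)\<^sup>2 - m\<^sup>2 * (density x)\<^sup>2) / density x" for x
  have "g x = 0"
  proof (rule fundamental_lemma_calculus_of_variations[OF open_domain _ _ assms(2)])
    show "continuous_on \<Omega> g"
      unfolding g_def using density_positive
      by (intro continuous_intros continuous_on_kinetic continuous_on_density) force
    fix h :: "real ^ 3 \<Rightarrow> real" assume h: "test_field \<Omega> h"
    define \<phi> where "\<phi> = (\<lambda>x. h x *\<^sub>R \<eta> x)"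
    have \<phi>: "test_field \<Omega> \<phi>"
      unfolding \<phi>_def by (rule test_field_scaleR[OF open_domain h smooth_spinor])
    have "deriv (\<lambda>t::real. lagrangian r m A (\<lambda>y. \<eta> y + t *\<^sub>R \<phi> y) x) 0 = - (32 / 9) * (h x * g x)"
      if "x \<in> \<Omega>" for x
    proof -
      \<comment> \<open>By skewness a real rescaling of \<eta> produces no divergence term, so the
        variation is purely pointwise.\<close>
      have "\<eta> y \<bullet> isigma \<alpha> (\<phi> y) = 0" for \<alpha> y
        using inner_isigma[of "\<eta> y" \<alpha> "\<eta> y"]
        by (simp add: \<phi>_def inner_commute linear_scale[OF bounded_linear.linear[OF bounded_linear_isigma]])
      moreover have "\<phi> differentiable (at x)"
        using \<phi> smooth_on_imp_differentiable by (auto simp: test_field_def)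
      ultimately have "deriv (\<lambda>t::real. lagrangian r m A (\<lambda>y. \<eta> y + t *\<^sub>R \<phi> y) x) 0 =
        - (16 / 9) * ((4 * kinetic x * (h x * kinetic x) - 4 * m\<^sup>2 * density x * (h x * density x)) / density x
        - 2 * (h x * density x) * ((kinetic x)\<^sup>2 - m\<^sup>2 * (density x)\<^sup>2) / (density x)\<^sup>2)"
        by (simp add: deriv_lagrangian_eq[OF that]) (simp add: \<phi>_def kinetic_def density_def)
      also have "\<dots> = - (32 / 9) * (h x * g x)"
        using density_positive[OF that] by (simp add: g_def field_simps power2_eq_square)
      finally show ?thesis .
    qed
    moreover have "((\<lambda>x. deriv (\<lambda>t::real. lagrangian r m A (\<lambda>y. \<eta> y + t *\<^sub>R \<phi> y) x) 0) has_integral 0) \<Omega>"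
      using assms(1) \<phi> by (simp add: field_equation_def)
    ultimately have "((\<lambda>x. - (32 / 9) * (h x * g x)) has_integral 0) \<Omega>"
      by (rule has_integral_eq)
    from has_integral_mult_right[OF this, of "- (9 / 32)"]
    show "((\<lambda>x. h x * g x) has_integral 0) \<Omega>"
      by (simp add: mult.commute)
  qed
  then show ?thesis
    using density_positive[OF assms(2)] m
    by (simp add: g_def mass_sign_def power_divide power_mult_distrib)
qed

text \<open>Once the sign squares to 1, the term from varying the denominator vanishes, and
  substituting the kinetic form cancels the density. What remains is 32/9 m times (2
  \<open>E\<close> + \<open>V\<close>), where \<open>V\<close> integrates to 0 because the sign is
  locally constant.\<close>

lemma first_variation:
  assumes square: "\<And>x. x \<in> \<Omega> \<Longrightarrow> (mass_sign x)\<^sup>2 = 1" and \<phi>: "test_field \<Omega> \<phi>"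
  shows "((\<lambda>x. deriv (\<lambda>t::real. lagrangian r m A (\<lambda>y. \<eta> y + t *\<^sub>R \<phi> y) x) 0) has_integral 0) \<Omega> \<longleftrightarrow>
    ((\<lambda>x. \<phi> x \<bullet> (mass_sign x *\<^sub>R massless_dirac r A \<eta> x + m *\<^sub>R sigma3 (\<eta> x))) has_integral 0) \<Omega>"
proof -
  define V where "V x = mass_sign x * (\<Sum>\<alpha>\<in>UNIV. partial \<alpha> (\<lambda>y. \<eta> y \<bullet> isigma \<alpha> (\<phi> y)) x)" for x
  define E where "E x = \<phi> x \<bullet> (mass_sign x *\<^sub>R massless_dirac r A \<eta> x + m *\<^sub>R sigma3 (\<eta> x))" for x
  have "mass_sign ` \<Omega> \<subseteq> {1, - 1}"
    using square by (auto simp: power2_eq_1_iff)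
  then have "finite (mass_sign ` \<Omega>)"
    by (rule finite_subset) simp
  then have V: "(V has_integral 0) \<Omega>"
    unfolding V_def
    by (intro has_integral_signed_divergence open_domain smooth_spinor \<phi> continuous_on_mass_sign)
  have "deriv (\<lambda>t::real. lagrangian r m A (\<lambda>y. \<eta> y + t *\<^sub>R \<phi> y) x) 0 = 32 / 9 * m * (2 * E x + V x)"
    if "x \<in> \<Omega>" for x
  proof -
    have "\<phi> differentiable (at x)"
      using \<phi> smooth_on_imp_differentiable by (auto simp: test_field_def)
    moreover have "(kinetic x)\<^sup>2 = m\<^sup>2 * (density x)\<^sup>2"
      using square[OF that] by (simp add: kinetic_eq[OF that] power_mult_distrib)
    ultimately have "deriv (\<lambda>t::real. lagrangian r m A (\<lambda>y. \<eta> y + t *\<^sub>R \<phi> y) x) 0 =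
      - (16 / 9) * ((2 * kinetic x * (2 * (\<phi> x \<bullet> massless_dirac r A \<eta> x) +
      (\<Sum>\<alpha>\<in>UNIV. partial \<alpha> (\<lambda>y. \<eta> y \<bullet> isigma \<alpha> (\<phi> y)) x)) - 4 * m\<^sup>2 * density x * (\<phi> x \<bullet> sigma3 (\<eta> x))) / density x)"
      using deriv_lagrangian_eq[OF that, of \<phi>] by simp
    also have "\<dots> = 32 / 9 * m * (2 * E x + V x)"
      using density_positive[OF that]
      by (simp add: kinetic_eq[OF that] E_def V_def inner_add_right field_simps power2_eq_square)
    finally show ?thesis .
  qed
  then have "((\<lambda>x. deriv (\<lambda>t::real. lagrangian r m A (\<lambda>y. \<eta> y + t *\<^sub>R \<phi> y) x) 0) has_integral 0) \<Omega> \<longleftrightarrow>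
      ((\<lambda>x. 32 / 9 * m * (2 * E x + V x)) has_integral 0) \<Omega>"
    by (intro has_integral_cong)
  also have "\<dots> \<longleftrightarrow> ((\<lambda>x. 2 * E x + V x) has_integral 0) \<Omega>"
    using has_integral_cmul_iff[of "32 / 9 * m" "\<lambda>x. 2 * E x + V x" 0 \<Omega>] m by simp
  also have "\<dots> \<longleftrightarrow> ((\<lambda>x. 2 * E x) has_integral 0) \<Omega>"
    using has_integral_add[OF _ V, of "\<lambda>x. 2 * E x" 0] has_integral_diff[OF _ V, of "\<lambda>x. 2 * E x + V x" 0]
    by auto
  also have "\<dots> \<longleftrightarrow> (E has_integral 0) \<Omega>"
    using has_integral_cmul_iff[of 2 E 0 \<Omega>] by simp
  finally show ?thesis
    by (simp add: E_def[abs_def])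
qed

text \<open>The alternative is first obtained point by point; choosing the same sign throughout a
  connected set is left to a separate topological argument.\<close>

lemma field_equation_iff:
  "field_equation \<Omega> (lagrangian r m A) \<eta> \<longleftrightarrow>
    (\<forall>x\<in>\<Omega>. dirac r 1 m A \<eta> x = 0 \<or> dirac r (- 1) m A \<eta> x = 0)"
proof
  assume fe: "field_equation \<Omega> (lagrangian r m A) \<eta>"
  show "\<forall>x\<in>\<Omega>. dirac r 1 m A \<eta> x = 0 \<or> dirac r (- 1) m A \<eta> x = 0"
  proof
    fix x assume x: "x \<in> \<Omega>"
    define F where "F x = mass_sign x *\<^sub>R massless_dirac r A \<eta> x + m *\<^sub>R sigma3 (\<eta> x)" for x
    have "F x \<bullet> F x = 0"
    \<comment> \<open>Test fields that are a bump times the constant spinor \<open>F x\<close>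
      reduce the spinor equation to the scalar lemma; evaluation at \<open>x\<close> gives |F x|^2 =
      0.\<close>
    proof (rule fundamental_lemma_calculus_of_variations[OF open_domain _ _ x, of "\<lambda>y. F x \<bullet> F y"])
      show "continuous_on \<Omega> (\<lambda>y. F x \<bullet> F y)"
        unfolding F_def
        by (intro continuous_intros continuous_on_mass_sign
            continuous_on_massless_dirac[OF smooth_potential smooth_spinor]
            bounded_linear.continuous_on[OF bounded_linear_matrix_vector]
            smooth_on_imp_continuous_on[OF smooth_spinor])
      fix h :: "real ^ 3 \<Rightarrow> real" assume h: "test_field \<Omega> h"
      have "test_field \<Omega> (\<lambda>y. h y *\<^sub>R F x)"
        by (rule test_field_scaleR[OF open_domain h]) (simp add: smooth_on_def Ck_on_const)
      then have "((\<lambda>y. (h y *\<^sub>R F x) \<bullet> F y) has_integral 0) \<Omega>"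
        using fe first_variation[OF mass_sign_square[OF fe]] unfolding field_equation_def F_def by blast
      then show "((\<lambda>y. h y * (F x \<bullet> F y)) has_integral 0) \<Omega>"
        by simp
    qed
    then have "F x = 0" by simp
    moreover have "mass_sign x = 1 \<or> mass_sign x = - 1"
      using mass_sign_square[OF fe x] by (simp add: power2_eq_1_iff)
    ultimately show "dirac r 1 m A \<eta> x = 0 \<or> dirac r (- 1) m A \<eta> x = 0"
      by (auto simp: F_def dirac_eq[OF differentiable[OF x]])
  qed
next
  assume D: "\<forall>x\<in>\<Omega>. dirac r 1 m A \<eta> x = 0 \<or> dirac r (- 1) m A \<eta> x = 0"
  have sq: "(mass_sign x)\<^sup>2 = 1" if "x \<in> \<Omega>" for x
    using D that mass_sign_eq[OF that] by auto
  \<comment> \<open>Whichever Dirac equation holds at the point, \<open>mass_sign\<close> recovers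
    its sign, and the equation times that sign is the claim.\<close>
  have "mass_sign x *\<^sub>R massless_dirac r A \<eta> x + m *\<^sub>R sigma3 (\<eta> x) = 0" if "x \<in> \<Omega>" for x
    using bspec[OF D that] mass_sign_eq[OF that] dirac_imp_massless_dirac[OF differentiable[OF that]]
    by auto
  then show "field_equation \<Omega> (lagrangian r m A) \<eta>"
    unfolding field_equation_def using first_variation[OF sq]
    by (auto intro!: has_integral_is_0)
qed

text \<open>On \<open>C\<close> the continuous function \<open>mass_sign\<close> takes only the
  values 1 and -1, so it is constant there. It names the Dirac equation valid at each point, hence
  the same one holds on all of \<open>C\<close>.\<close>

lemma dirac_alternative_connected:
  assumes "C \<subseteq> \<Omega>" "connected C"
  shows "(\<forall>x\<in>C. dirac r 1 m A \<eta> x = 0 \<or> dirac r (- 1) m A \<eta> x = 0) \<longleftrightarrow>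
    dirac_solution C r 1 m A \<eta> \<or> dirac_solution C r (- 1) m A \<eta>" (is "?L \<longleftrightarrow> ?R")
proof
  assume L: ?L
  have "mass_sign x \<in> {1, - 1}" if "x \<in> C" for x
    using L that assms(1) mass_sign_eq by auto
  then have "mass_sign ` C \<subseteq> {1, - 1}"
    by blast
  then have "finite (mass_sign ` C)"
    by (rule finite_subset) simp
  then have "mass_sign constant_on C"
    by (intro continuous_finite_range_constant assms(2)
        continuous_on_subset[OF continuous_on_mass_sign assms(1)])
  then obtain c where "\<And>x. x \<in> C \<Longrightarrow> mass_sign x = c"
    by (auto simp: constant_on_def)
  then have "dirac r \<sigma> m A \<eta> x = 0 \<Longrightarrow> \<sigma> = c" if "x \<in> C" for x \<sigma>
    using mass_sign_eq that assms(1) by (metis subsetD)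
  with L show ?R
    unfolding dirac_solution_def by (metis one_neq_neg_one)
qed (auto simp: dirac_solution_def)

theorem field_equation_iff_components:
  "field_equation \<Omega> (lagrangian r m A) \<eta> \<longleftrightarrow>
    (\<forall>C\<in>components \<Omega>. dirac_solution C r 1 m A \<eta> \<or> dirac_solution C r (- 1) m A \<eta>)"
proof -
  let ?P = "\<lambda>x. dirac r 1 m A \<eta> x = 0 \<or> dirac r (- 1) m A \<eta> x = 0"
  have "(\<forall>x\<in>\<Omega>. ?P x) \<longleftrightarrow> (\<forall>C\<in>components \<Omega>. \<forall>x\<in>C. ?P x)"
    using Union_components[of \<Omega>] by blast
  also have "\<dots> \<longleftrightarrow> (\<forall>C\<in>components \<Omega>. dirac_solution C r 1 m A \<eta> \<or> dirac_solution C r (- 1) m A \<eta>)"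
    by (intro ball_cong refl dirac_alternative_connected in_components_subset in_components_connected)
  finally show ?thesis
    unfolding field_equation_iff .
qed

theorem field_equation_iff_connected:
  assumes "connected \<Omega>"
  shows "field_equation \<Omega> (lagrangian r m A) \<eta> \<longleftrightarrow>
    dirac_solution \<Omega> r 1 m A \<eta> \<or> dirac_solution \<Omega> r (- 1) m A \<eta>"
  using field_equation_iff dirac_alternative_connected[OF order_refl assms] by simp

end

theorem theorem1:
  fixes m :: real
    and \<Omega> :: "(real ^ 3) set"
    and A :: "real ^ 3 \<Rightarrow> real ^ 3"
    and \<eta> :: "real ^ 3 \<Rightarrow> complex ^ 2"
  assumes "m > 0"
    and "open \<Omega>"
    and "smooth_on UNIV A"
    and "smooth_on \<Omega> \<eta>"
    and "\<And>x. x \<in> \<Omega> \<Longrightarrow> Re (sigma3_form (\<eta> x)) > 0"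
  shows
    "(connected \<Omega> \<longrightarrow>
        (field_equation \<Omega> (lagrangian 1 m A) \<eta> \<longleftrightarrow>
           dirac_solution \<Omega> 1 1 m A \<eta> \<or> dirac_solution \<Omega> 1 (- 1) m A \<eta>) \<and>
        (field_equation \<Omega> (lagrangian (- 1) m A) \<eta> \<longleftrightarrow>
           dirac_solution \<Omega> (- 1) 1 m A \<eta> \<or> dirac_solution \<Omega> (- 1) (- 1) m A \<eta>)) \<and>
     (field_equation \<Omega> (lagrangian 1 m A) \<eta> \<longleftrightarrow>
        (\<forall>C\<in>components \<Omega>.
           dirac_solution C 1 1 m A \<eta> \<or> dirac_solution C 1 (- 1) m A \<eta>)) \<and>
     (field_equation \<Omega> (lagrangian (- 1) m A) \<eta> \<longleftrightarrow>
        (\<forall>C\<in>components \<Omega>.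
           dirac_solution C (- 1) 1 m A \<eta> \<or> dirac_solution C (- 1) (- 1) m A \<eta>))"
proof -
  have F: "spinor_field m \<Omega> A \<eta>"
    using assms by unfold_locales
  show ?thesis
    using spinor_field.field_equation_iff_connected[OF F] spinor_field.field_equation_iff_components[OF F]
    by blast
qed

end
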